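(* Let $\alpha\in(0,\infty)\setminus\{1\}$. Given channels $W_1\sim\rho_{X_1B_1}$ and $W_2\sim\rho_{X_2B_2}$ (binary-input classical-quantum channels with uniform input, as defined in the context), there exist channels $W_1'$ and $W_2'$ (in the same sense) with $\widetilde H^\downarrow_\alpha(W_i)=\bar H^\uparrow_{1/\alpha}(W_i')$ for $i=1,2$ such that $$\widetilde H^\downarrow_\alpha(W_1)+\widetilde H^\downarrow_\alpha(W_2)=\bar H^\uparrow_{1/\alpha}(W_1'\circledast W_2')+\widetilde H^\downarrow_\alpha(W_1\boxplus W_2).$$ More precisely, these channels are given by $$W_i'\sim\bar\rho_{X_iB_i}=\frac{\Big(\rho_{B_i}^{\frac{1-\alpha}{2\alpha}}\rho_{X_iB_i}\,\rho_{B_i}^{\frac{1-\alpha}{2\alpha}}\Big)^\alpha}{\operatorname{Tr}\Big(\rho_{B_i}^{\frac{1-\alpha}{2\alpha}}\rho_{X_iB_i}\,\rho_{B_i}^{\frac{1-\alpha}{2\alpha}}\Big)^\alpha},\qquad i=1,2.$$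
   Context: All systems are finite-dimensional; powers of positive semidefinite matrices (including negative ones) are taken on the support; $\rho_B^s$ inside an expression on $AB$ means $I_A\otimes\rho_B^s$; $\operatorname{Tr}(M)^\alpha$ means $\operatorname{Tr}(M^\alpha)$; $\log$ is natural. For $\alpha\in(0,\infty)\setminus\{1\}$ and a quantum state $\rho_{AB}$ with marginal $\rho_B=\operatorname{Tr}_A\rho_{AB}$, $$\widetilde H^\downarrow_\alpha(A|B)_\rho=\frac{1}{1-\alpha}\log\operatorname{Tr}\Big[\Big(\rho_B^{\frac{1-\alpha}{2\alpha}}\rho_{AB}\,\rho_B^{\frac{1-\alpha}{2\alpha}}\Big)^\alpha\Big],\qquad \bar H^\uparrow_\alpha(A|B)_\rho=\frac{\alpha}{1-\alpha}\log\operatorname{Tr}\Big[\big(\operatorname{Tr}_A\rho_{AB}^\alpha\big)^{1/\alpha}\Big].$$ A channel $W\sim\rho_{XB}$ is a binary-input classical-quantum channel identified with the classical-quantum state with uniform input $$\rho_{XB}=\tfrac12|0\rangle\langle0|\otimes\sigma_0^{B}+\tfrac12|1\rangle\langle1|\otimes\sigma_1^{B},$$ where $\sigma_0^B,\sigma_1^B$ are quantum states. Write $H(W)=H(X|B)_\rho$ for $H$ either of the two entropies above. Given two channels $W_1$ and $W_2$, with output states $\sigma_0^{B_1},\sigma_1^{B_1}$ and $\sigma_0^{B_2},\sigma_1^{B_2}$ respectively, applying a CNOT gate to the classical systems gives the combined state $$\tau^{(X_1+X_2)X_2B_1B_2}=\sum_{z,x_2\in\{0,1\}}\tfrac14\,|z\oplus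 x_2\rangle\langle z\oplus x_2|\otimes|x_2\rangle\langle x_2|\otimes\sigma_{z}^{B_1}\otimes\sigma_{x_2}^{B_2},$$ where $\oplus$ is addition modulo 2, and one defines $$H(W_1\boxplus W_2)=H(X_1+X_2\,|\,B_1B_2)_\tau,\qquad H(W_1\circledast W_2)=H(X_2\,|\,X_1+X_2,B_1B_2)_\tau,$$ where in the second expression the classical register $X_1+X_2$ is part of the conditioning system.
   Formalization: Since ρ̄ need not have uniform input, the claim is split: uniform-input channels W_i' satisfying all equations exist, and the explicit ρ̄ satisfy the same equations as classical-quantum states with some, possibly non-uniform, input distribution. *)

theory Defs
  imports "HOL-Analysis.Analysis" "HOL-Library.Z2"
begin

section \<open>Operators on finite-dimensional systems\<close>

text \<open>
  A system with orthonormal basis indexed by a finite type \<open>'n\<close> carries the operators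
  \<open>'n op\<close>; the composite of systems \<open>'m\<close> and \<open>'n\<close> is indexed by \<open>'m \<times> 'n\<close>.
\<close>

type_synonym 'n op = "complex^'n^'n"

definition dagger :: "complex^'n^'m \<Rightarrow> complex^'m^'n" where
  "dagger M = (\<chi> i j. cnj (M $ j $ i))"

definition psd :: "'n::finite op \<Rightarrow> bool" where
  "psd M \<longleftrightarrow> dagger M = M \<and> (\<forall>v. 0 \<le> Re (\<Sum>i\<in>UNIV. cnj (v $ i) * (M *v v) $ i))"

definition density_op :: "'n::finite op \<Rightarrow> bool" where
  "density_op M \<longleftrightarrow> psd M \<and> trace M = 1"

definition diagm :: "('n \<Rightarrow> real) \<Rightarrow> 'n::finite op" where
  "diagm d = (\<chi> i j. if i = j then complex_of_real (d i) else 0)"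

definition unitary :: "'n::finite op \<Rightarrow> bool" where
  "unitary U \<longleftrightarrow> dagger U ** U = mat 1 \<and> U ** dagger U = mat 1"

text \<open>
  Real power of a positive semidefinite operator, through a unitary diagonalization.
  Since \<open>0 powr s = 0\<close> for every real \<open>s\<close>, including \<open>s \<le> 0\<close>, the power is taken on
  the support. It is meaningful for positive semidefinite operators only. It does not depend
  on the chosen diagonalization, see \<open>powm_unique\<close> below.
\<close>

definition is_powm :: "'n::finite op \<Rightarrow> real \<Rightarrow> 'n op \<Rightarrow> bool" where
  "is_powm M s R \<longleftrightarrow> (\<exists>U d. unitary U \<and> (\<forall>i. 0 \<le> d i) \<and>
      M = U ** diagm d ** dagger U \<and> R = U ** diagm (\<lambda>i. d i powr s) ** dagger U)"

definition powm :: "'n::finite op \<Rightarrow> real \<Rightarrow> 'n op" where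
  "powm M s = (THE R. is_powm M s R)"

definition tensor :: "'m::finite op \<Rightarrow> 'n::finite op \<Rightarrow> ('m \<times> 'n) op" (infixr "\<otimes>" 72) where
  "A \<otimes> B = (\<chi> i j. A $ fst i $ fst j * B $ snd i $ snd j)"

definition ketbra :: "'n \<Rightarrow> 'n::finite op" where
  "ketbra x = (\<chi> i j. if i = x \<and> j = x then 1 else 0)"

definition ptrace_fst :: "('m::finite \<times> 'n::finite) op \<Rightarrow> 'n op" where
  "ptrace_fst M = (\<chi> k l. \<Sum>i\<in>UNIV. M $ (i, k) $ (i, l))"

definition reindex :: "('m \<Rightarrow> 'n) \<Rightarrow> 'n::finite op \<Rightarrow> 'm::finite op" where
  "reindex f M = (\<chi> i j. M $ f i $ f j)"


section \<open>Conditional Renyi entropies\<close>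

text \<open>The operator \<open>\<rho>\<^sub>B\<^sup>s \<rho>\<^sub>A\<^sub>B \<rho>\<^sub>B\<^sup>s\<close> with \<open>s = (1 - \<alpha>) / (2\<alpha>)\<close>.\<close>

definition sandwich :: "real \<Rightarrow> ('a::finite \<times> 'b::finite) op \<Rightarrow> ('a \<times> 'b) op" where
  "sandwich \<alpha> \<rho> =
     (let S = mat 1 \<otimes> powm (ptrace_fst \<rho>) ((1 - \<alpha>) / (2 * \<alpha>)) in S ** \<rho> ** S)"

text \<open>
  The traces below are those of positive semidefinite operators, hence real; \<open>Re\<close> only adapts
  the type.
\<close>

definition H_sandwiched_down :: "real \<Rightarrow> ('a::finite \<times> 'b::finite) op \<Rightarrow> real" where
  "H_sandwiched_down \<alpha> \<rho> = 1 / (1 - \<alpha>) * ln (Re (trace (powm (sandwich \<alpha> \<rho>) \<alpha>)))"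

definition H_petz_up :: "real \<Rightarrow> ('a::finite \<times> 'b::finite) op \<Rightarrow> real" where
  "H_petz_up \<alpha> \<rho> =
     \<alpha> / (1 - \<alpha>) * ln (Re (trace (powm (ptrace_fst (powm \<rho> \<alpha>)) (1 / \<alpha>))))"


section \<open>Binary-input classical-quantum channels\<close>

text \<open>
  The classical register is indexed by \<^typ>\<open>bit\<close>, whose addition is addition modulo 2.
  A channel is identified with its classical-quantum state.
\<close>

instance bit :: finite
proof
  have "(UNIV :: bit set) = {0, 1}"
    by (auto intro: bit.exhaust)
  then show "finite (UNIV :: bit set)"
    by (rule ssubst) simp
qed

definition cq_state :: "(bit \<Rightarrow> real) \<Rightarrow> (bit \<times> 'b::finite) op \<Rightarrow> bool" where
  "cq_state p \<rho> \<longleftrightarrow> (\<forall>x. 0 \<le> p x) \<and> (\<Sum>x\<in>UNIV. p x) = 1 \<and>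
     (\<exists>\<sigma>. (\<forall>x. density_op (\<sigma> x)) \<and> \<rho> = (\<Sum>x\<in>UNIV. p x *\<^sub>R (ketbra x \<otimes> \<sigma> x)))"

definition channel :: "(bit \<times> 'b::finite) op \<Rightarrow> bool" where
  "channel \<rho> \<longleftrightarrow> cq_state (\<lambda>_. 1 / 2) \<rho>"

text \<open>
  \<open>block \<rho> x\<close> is \<open>p x *\<^sub>R \<sigma> x\<close> for the state above.
  Hence \<open>cnot_state\<close> is the result of the CNOT \<open>(x\<^sub>1, x\<^sub>2) \<mapsto> (x\<^sub>1 + x\<^sub>2, x\<^sub>2)\<close> for arbitrary
  input distributions; \<open>cnot_state_uniform\<close> gives the formula for channels.
\<close>

definition block :: "(bit \<times> 'b::finite) op \<Rightarrow> bit \<Rightarrow> 'b op" where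
  "block \<rho> x = (\<chi> i j. \<rho> $ (x, i) $ (x, j))"

definition cnot_state ::
  "(bit \<times> 'b::finite) op \<Rightarrow> (bit \<times> 'c::finite) op \<Rightarrow> (bit \<times> bit \<times> 'b \<times> 'c) op" where
  "cnot_state \<rho>\<^sub>1 \<rho>\<^sub>2 = (\<Sum>z\<in>UNIV. \<Sum>x\<^sub>2\<in>UNIV.
      ketbra (z + x\<^sub>2) \<otimes> ketbra x\<^sub>2 \<otimes> block \<rho>\<^sub>1 z \<otimes> block \<rho>\<^sub>2 x\<^sub>2)"

text \<open>
  The states on which the entropies of the combined channels are evaluated, the first tensor
  factor being the system whose entropy is taken: the marginal on \<open>(X\<^sub>1 + X\<^sub>2) (B\<^sub>1 B\<^sub>2)\<close>, and
  the full state with its registers reordered as \<open>X\<^sub>2 ((X\<^sub>1 + X\<^sub>2) B\<^sub>1 B\<^sub>2)\<close>.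
\<close>

definition circledast ::
  "(bit \<times> 'b::finite) op \<Rightarrow> (bit \<times> 'c::finite) op \<Rightarrow> (bit \<times> bit \<times> 'b \<times> 'c) op"
  (infixl "\<circledast>" 70) where
  "W\<^sub>1 \<circledast> W\<^sub>2 = reindex (\<lambda>(x\<^sub>2, u, b). (u, x\<^sub>2, b)) (cnot_state W\<^sub>1 W\<^sub>2)"

definition boxplus ::
  "(bit \<times> 'b::finite) op \<Rightarrow> (bit \<times> 'c::finite) op \<Rightarrow> (bit \<times> 'b \<times> 'c) op"
  (infixl "\<boxplus>" 70) where
  "W\<^sub>1 \<boxplus> W\<^sub>2 = ptrace_fst (reindex (\<lambda>(x\<^sub>2, u, b). (u, x\<^sub>2, b)) (cnot_state W\<^sub>1 W\<^sub>2))"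

text \<open>
  This is a classical-quantum state, but its input distribution is in general not uniform.
\<close>

definition rho_bar :: "real \<Rightarrow> (bit \<times> 'b::finite) op \<Rightarrow> (bit \<times> 'b) op" where
  "rho_bar \<alpha> \<rho> =
     (1 / Re (trace (powm (sandwich \<alpha> \<rho>) \<alpha>))) *\<^sub>R powm (sandwich \<alpha> \<rho>) \<alpha>"


section \<open>Consistency of the definitions\<close>

lemma diagm_mult_left: "(diagm d ** M) $ i $ j = complex_of_real (d i) * M $ i $ j"
  by (simp add: diagm_def matrix_matrix_mult_def if_distrib if_distribR cong: if_cong)

lemma diagm_mult_right: "(M ** diagm d) $ i $ j = M $ i $ j * complex_of_real (d j)"
  by (simp add: diagm_def matrix_matrix_mult_def if_distrib if_distribR cong: if_cong)

lemma is_powm_unique: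
  fixes M :: "'n::finite op"
  assumes "is_powm M s R" "is_powm M s R'"
  shows "R = R'"
proof -
  obtain U d where U: "unitary U" and M: "M = U ** diagm d ** dagger U"
    and R: "R = U ** diagm (\<lambda>i. d i powr s) ** dagger U"
    using assms(1) by (auto simp: is_powm_def)
  obtain V e where V: "unitary V" and M': "M = V ** diagm e ** dagger V"
    and R': "R' = V ** diagm (\<lambda>i. e i powr s) ** dagger V"
    using assms(2) by (auto simp: is_powm_def)
  define W where "W = dagger V ** U"
  have cancel_U: "\<And>A. A ** dagger U ** U = A" "\<And>A. A ** U ** dagger U = A"
    using U by (simp_all add: unitary_def flip: matrix_mul_assoc)
  have cancel_V: "\<And>A. dagger V ** (V ** A) = A" "\<And>A. V ** (dagger V ** A) = A"
    using V by (simp_all add: unitary_def matrix_mul_assoc)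
  have "dagger V ** M ** U = W ** diagm d"
    unfolding M W_def by (simp add: matrix_mul_assoc cancel_U)
  moreover have "dagger V ** M ** U = diagm e ** W"
    unfolding M' W_def by (simp add: cancel_V flip: matrix_mul_assoc)
  ultimately have "W $ i $ j * complex_of_real (d j) = complex_of_real (e i) * W $ i $ j" for i j
    by (metis diagm_mult_left diagm_mult_right)
  then have "W $ i $ j = 0 \<or> d j = e i" for i j
    by (metis mult.commute mult_left_cancel of_real_eq_iff)
  then have *: "W ** diagm (\<lambda>i. d i powr s) = diagm (\<lambda>i. e i powr s) ** W"
    by (auto simp: vec_eq_iff diagm_mult_left diagm_mult_right) (metis mult.commute mult_zero_left)
  have "R = V ** (W ** diagm (\<lambda>i. d i powr s)) ** dagger U"
    unfolding R W_def by (simp add: cancel_V flip: matrix_mul_assoc)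
  also have "\<dots> = R'"
    unfolding * unfolding R' W_def by (simp add: matrix_mul_assoc cancel_U)
  finally show ?thesis .
qed

lemma powm_unique: "is_powm M s R \<Longrightarrow> powm M s = R"
  unfolding powm_def by (blast intro: the_equality is_powm_unique)

lemma block_cq: "block (\<Sum>x\<in>UNIV. p x *\<^sub>R (ketbra x \<otimes> \<sigma> x)) x = p x *\<^sub>R \<sigma> x"
proof -
  have "(\<Sum>z\<in>UNIV. p z *\<^sub>R ((if x = z then 1 else 0) * \<sigma> z $ i $ j)) = p x *\<^sub>R \<sigma> x $ i $ j"
    for i j
    by (subst sum.remove[of _ x]) (auto intro!: sum.neutral)
  then show ?thesis
    by (simp add: vec_eq_iff block_def ketbra_def tensor_def)
qed

lemma cnot_state_uniform:
  fixes \<sigma>\<^sub>1 :: "bit \<Rightarrow> 'b::finite op" and \<sigma>\<^sub>2 :: "bit \<Rightarrow> 'c::finite op"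
  shows "cnot_state (\<Sum>x\<in>UNIV. (1 / 2) *\<^sub>R (ketbra x \<otimes> \<sigma>\<^sub>1 x)) (\<Sum>x\<in>UNIV. (1 / 2) *\<^sub>R (ketbra x \<otimes> \<sigma>\<^sub>2 x)) =
    (\<Sum>z\<in>UNIV. \<Sum>x\<^sub>2\<in>UNIV. (1 / 4) *\<^sub>R (ketbra (z + x\<^sub>2) \<otimes> ketbra x\<^sub>2 \<otimes> \<sigma>\<^sub>1 z \<otimes> \<sigma>\<^sub>2 x\<^sub>2))"
  unfolding cnot_state_def block_cq
  by (intro sum.cong refl) (simp add: vec_eq_iff tensor_def)

end

(* Write T x for the blocks of the sandwiched operator. Commuting powers of the marginal give
   sum_x T x = rho_B^(1/alpha), so the entropy of rho_bar, which sums the blocks (T x)^alpha only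
   after raising them to 1/alpha, collapses to the normalization of rho_bar. The same cancellation of
   exponents turns the circledast of the two rho_bar into the sandwiched operator of the boxplus of
   the given channels, because the marginal of the latter is a tensor product. The input of rho_bar
   need not be uniform; adding a uniform bit to the input and handing it to the receiver makes it
   uniform at no cost in entropy. *)
theory Submission
  imports Defs
begin

text \<open>\<open>powm\<close> is a definite description over unitary diagonalizations, so nothing
  can be computed from it until a diagonalization is known to exist; hence the spectral theorem for
  positive semidefinite operators. The exponent s = (1 - \<alpha>) / (2 \<alpha>) is the one with s
  + 1 + s = 1 / \<alpha>, and at order 1 / \<alpha> the inner power of the Petz entropy undoes the
  power \<alpha> in \<open>rho_bar\<close>. The prefactor at that order is (1 / \<alpha>) / (1 - 1 /
  \<alpha>) = - 1 / (1 - \<alpha>). Its sign turns the two normalizations 1 / Z into the two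
  entropies of the given channels, and the remaining trace into minus the entropy of their boxplus.
  The weights of \<open>rho_bar\<close> can really fail to be uniform: for \<alpha> = 3 and the
  qubit outputs |0><0| and half the identity they are 4/9 and 5/9. The prescribed formula and
  uniform input therefore cannot in general be met by one state, and the theorem treats them in
  separate conjuncts.\<close>

section \<open>Spectral theorem\<close>

definition hdot :: "complex^'n \<Rightarrow> complex^'n::finite \<Rightarrow> complex" where
  "hdot x y = (\<Sum>i\<in>UNIV. cnj (x $ i) * y $ i)"

lemma hdot_add: "hdot x (y + z) = hdot x y + hdot x z"
  and hdot_diff: "hdot x (y - z) = hdot x y - hdot x z"
  and hdot_scaleR: "hdot x (r *\<^sub>R y) = of_real r * hdot x y"
  and hdot_smult: "hdot x (c *s y) = c * hdot x y"
  and hdot_smult_left: "hdot (c *s x) y = cnj c * hdot x y"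
  by (simp_all add: hdot_def algebra_simps sum.distrib sum_subtractf sum_distrib_left
      vector_scalar_mult_def scaleR_conv_of_real[where 'a = complex])

lemma hdot_commute: "hdot y x = cnj (hdot x y)"
  by (simp add: hdot_def mult.commute)

lemma Re_hdot: "Re (hdot x y) = inner x y"
  by (simp add: hdot_def inner_vec_def inner_complex_def)

lemma Im_hdot: "Im (hdot x y) = inner (\<i> *s x) y"
  by (simp add: hdot_smult_left flip: Re_hdot)

lemma dagger_dagger [simp]: "dagger (dagger M) = M"
  by (simp add: dagger_def vec_eq_iff)

lemma dagger_mult: "dagger (A ** B) = dagger B ** dagger A"
  by (simp add: dagger_def matrix_matrix_mult_def vec_eq_iff mult.commute)

lemma dagger_diagm [simp]: "dagger (diagm d) = diagm d"
  by (auto simp: dagger_def diagm_def vec_eq_iff)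

lemma hdot_matrix: "hdot x (M *v y) = hdot (dagger M *v x) y"
proof -
  have "hdot x (M *v y) = (\<Sum>i\<in>UNIV. \<Sum>j\<in>UNIV. cnj (x $ i) * (M $ i $ j * y $ j))"
    by (simp add: hdot_def matrix_vector_mult_def sum_distrib_left)
  also have "\<dots> = (\<Sum>j\<in>UNIV. \<Sum>i\<in>UNIV. cnj (x $ i) * (M $ i $ j * y $ j))"
    by (rule sum.swap)
  also have "\<dots> = hdot (dagger M *v x) y"
    by (simp add: hdot_def matrix_vector_mult_def sum_distrib_right dagger_def mult_ac
        cong: sum.cong) (simp add: sum_distrib_left mult_ac)
  finally show ?thesis .
qed

lemma matrix_scaleR_vector: "M *v (r *\<^sub>R x) = r *\<^sub>R (M *v x)" for M :: "'n::finite op"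
  by (simp add: vec_eq_iff matrix_vector_mult_def scaleR_sum_right)

lemma psd_iff_hdot: "psd M \<longleftrightarrow> dagger M = M \<and> (\<forall>v. 0 \<le> Re (hdot v (M *v v)))"
  by (simp add: psd_def hdot_def)

text \<open>For small positive t the linear term dominates. The choice t = a / (\<bar>K\<bar> + 1)
  gives t K \<le> a, so the quadratic is at most - t a, which is negative unless a = 0.\<close>

lemma quadratic_nonneg_imp_linear_zero:
  fixes a K :: real
  assumes "0 \<le> a" and nn: "\<And>t. 0 \<le> t\<^sup>2 * K - 2 * t * a"
  shows "a = 0"
proof (rule ccontr)
  assume "a \<noteq> 0"
  with \<open>0 \<le> a\<close> have a: "0 < a" by simp
  define t where "t = a / (\<bar>K\<bar> + 1)"
  have t: "0 < t" "t * (\<bar>K\<bar> + 1) = a"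
    using a by (simp_all add: t_def add_nonneg_pos abs_add_one_gt_zero less_imp_neq[symmetric])
  have "t * K \<le> t * (\<bar>K\<bar> + 1)"
    using t(1) by (intro mult_left_mono) auto
  then have "t * (t * K) \<le> t * a"
    using t by (intro mult_left_mono) auto
  moreover have "0 < t * a" using t a by simp
  ultimately show False using nn[of t] by (simp add: power2_eq_square mult_ac)
qed

text \<open>The eigenvector maximizes the Rayleigh quotient on the orthogonal complement of \<open>S\<close>.\<close>

lemma hermitian_eigenvector_orthogonal:
  fixes M :: "'n::finite op"
  assumes herm: "dagger M = M"
    and S: "\<And>v. v \<in> S \<Longrightarrow> \<exists>l::real. M *v v = of_real l *s v"
    and ex: "y \<noteq> 0" "\<And>v. v \<in> S \<Longrightarrow> hdot v y = 0"
  obtains x and l :: real where "norm x = 1" "\<And>v. v \<in> S \<Longrightarrow> hdot v x = 0" "M *v x = of_real l *s x"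
proof -
  define q where "q x = inner x (M *v x)" for x :: "complex^'n"
  define C where "C = {x. norm x = 1 \<and> (\<forall>v\<in>S. hdot v x = 0)}"
  have cont: "continuous_on A (hdot v)" for A and v :: "complex^'n"
    unfolding hdot_def by (intro continuous_intros)
  have C_eq: "C = sphere 0 1 \<inter> (\<Inter>v\<in>S. hdot v -` {0})"
    by (auto simp: C_def)
  have "closed (hdot v -` {0})" for v :: "complex^'n"
    using continuous_closed_vimage[of "{0}" "hdot v"] cont[of UNIV v]
    by (simp add: continuous_on_eq_continuous_within)
  then have "compact C"
    unfolding C_eq by (intro compact_Int_closed compact_sphere closed_INT) auto
  moreover have "(1 / norm y) *\<^sub>R y \<in> C"
    using ex by (simp add: C_def hdot_scaleR)
  moreover have "continuous_on C q"
    unfolding q_def matrix_vector_mult_def by (intro continuous_intros)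
  ultimately obtain x where x: "x \<in> C" and max: "\<And>z. z \<in> C \<Longrightarrow> q z \<le> q x"
    using continuous_attains_sup[of C q] by blast
  have nx: "inner x x = 1" using x by (simp add: C_def norm_eq_sqrt_inner)
  \<comment> \<open>Both sides are homogeneous of degree 2, so the maximum over unit vectors bounds
    every vector of the complement.\<close>
  have qle: "q z \<le> q x * inner z z" if z: "\<forall>v\<in>S. hdot v z = 0" for z
  proof (cases "z = 0")
    case True then show ?thesis by (simp add: q_def)
  next
    case False
    have "q ((1 / norm z) *\<^sub>R z) \<le> q x"
      using False z by (intro max) (simp add: C_def hdot_scaleR)
    also have "q ((1 / norm z) *\<^sub>R z) = q z / inner z z"
      by (simp add: q_def matrix_scaleR_vector power2_eq_square flip: power2_norm_eq_inner)
    finally show ?thesis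
      using False by (simp add: divide_le_eq)
  qed
  \<comment> \<open>The residual of the eigenvalue equation; moving the maximizer in its direction
    shows that it vanishes.\<close>
  define w where "w = M *v x - q x *\<^sub>R x"
  have sym: "inner a (M *v b) = inner (M *v a) b" for a b
    using hdot_matrix[of a M b] herm by (simp flip: Re_hdot)
  \<comment> \<open>\<open>S\<close> consists of eigenvectors of the Hermitian \<open>M\<close>, so
    \<open>M\<close> maps the orthogonal complement of \<open>S\<close> into itself, and x + t w
    stays admissible.\<close>
  have wS: "hdot v w = 0" if v: "v \<in> S" for v
  proof -
    obtain l :: real where l: "M *v v = of_real l *s v" using S[OF v] by blast
    have "hdot v x = 0" using x v by (simp add: C_def)
    then show ?thesis
      by (simp add: w_def hdot_diff hdot_scaleR hdot_matrix herm l hdot_smult_left)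
  qed
  have "inner w w = 0"
  \<comment> \<open>Expanding the bound \<open>qle\<close> at x + t w, the constant terms cancel,
    the linear coefficient is -2 times the squared norm of w, and the quadratic coefficient is the
    instance given here.\<close>
  proof (rule quadratic_nonneg_imp_linear_zero[of _ "q x * inner w w - q w"])
    fix t :: real
    have "q (x + t *\<^sub>R w) \<le> q x * inner (x + t *\<^sub>R w) (x + t *\<^sub>R w)"
      using x wS by (intro qle) (simp add: C_def hdot_add hdot_scaleR)
    moreover have "inner x (M *v w) = inner w (M *v x)"
      by (simp add: sym[of x] inner_commute)
    then have "q (x + t *\<^sub>R w) = q x + 2 * t * inner w (M *v x) + t\<^sup>2 * q w"
      by (simp add: q_def matrix_vector_right_distrib matrix_scaleR_vector inner_add_left
          inner_add_right power2_eq_square algebra_simps)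
    moreover have "inner w (M *v x) = inner w w + q x * inner x w"
      by (simp add: w_def inner_diff_left inner_diff_right inner_commute algebra_simps)
    ultimately show "0 \<le> t\<^sup>2 * (q x * inner w w - q w) - 2 * t * inner w w"
      using nx by (simp add: inner_add_left inner_add_right inner_commute power2_eq_square algebra_simps)
  qed simp
  then have "M *v x = of_real (q x) *s x"
    by (simp add: w_def vec_eq_iff vector_scalar_mult_def) (simp add: scaleR_conv_of_real[where 'a = complex])
  moreover have "norm x = 1" "\<And>v. v \<in> S \<Longrightarrow> hdot v x = 0" using x by (simp_all add: C_def)
  ultimately show ?thesis using that by blast
qed

text \<open>A count of real dimensions. Complex orthogonality to v i means real orthogonality to
  both v i and \<i> v i, so a proper subset \<open>I\<close> imposes at most 2 card I real
  conditions, fewer than the real dimension 2 CARD('n).\<close>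

lemma exists_orthogonal:
  fixes v :: "'n::finite \<Rightarrow> complex^'n"
  assumes "I \<noteq> UNIV"
  obtains y where "y \<noteq> 0" "\<And>i. i \<in> I \<Longrightarrow> hdot (v i) y = 0"
proof -
  define B where "B = v ` I \<union> (\<lambda>i. \<i> *s v i) ` I"
  have "dim (span B) \<le> card B"
    by (simp add: B_def dim_le_card')
  also have "card B \<le> card (v ` I) + card ((\<lambda>i. \<i> *s v i) ` I)"
    unfolding B_def by (rule card_Un_le)
  also have "\<dots> \<le> card I + card I" by (intro add_mono card_image_le) auto
  also have "\<dots> < 2 * CARD('n)"
    using psubset_card_mono[of UNIV I] assms by (simp add: psubset_eq)
  also have "\<dots> = DIM(complex^'n)" by simp
  finally obtain y where y: "y \<noteq> 0" "\<And>b. b \<in> span (span B) \<Longrightarrow> orthogonal y b"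
    using orthogonal_to_subspace_exists[of "span B"] by (auto simp: orthogonal_commute)
  have "hdot (v i) y = 0" if "i \<in> I" for i
  proof -
    have "v i \<in> span (span B)" "\<i> *s v i \<in> span (span B)"
      using that by (auto simp: B_def span_base)
    then have "inner (v i) y = 0" "inner (\<i> *s v i) y = 0"
      using y(2) by (simp_all add: orthogonal_def inner_commute[of _ y])
    then show ?thesis
      by (simp add: complex_eq_iff Re_hdot Im_hdot)
  qed
  with y(1) show ?thesis using that by blast
qed

text \<open>The basis type itself indexes the eigenvectors, so the induction extends a partial
  orthonormal family over subsets \<open>I\<close>, and \<open>I = UNIV\<close> yields a complete
  basis.\<close>

lemma hermitian_orthonormal_eigenvectors:
  fixes M :: "'n::finite op" and I :: "'n set"
  assumes "dagger M = M"
  shows "\<exists>v l. (\<forall>i\<in>I. \<forall>j\<in>I. hdot (v i) (v j) = (if i = j then 1 else 0)) \<and>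
           (\<forall>i\<in>I. M *v v i = complex_of_real (l i) *s v i)"
proof -
  have "finite I" by simp
  then show ?thesis
  proof (induction I rule: finite_induct)
    case empty
    then show ?case by simp
  next
    case (insert k I)
    then obtain v and l :: "'n \<Rightarrow> real" where
      orth: "\<And>i j. i \<in> I \<Longrightarrow> j \<in> I \<Longrightarrow> hdot (v i) (v j) = (if i = j then 1 else 0)"
      and eig: "\<And>i. i \<in> I \<Longrightarrow> M *v v i = complex_of_real (l i) *s v i"
      by blast
    have "I \<noteq> UNIV" using insert.hyps by auto
    then obtain y where y: "y \<noteq> 0" "\<And>i. i \<in> I \<Longrightarrow> hdot (v i) y = 0"
      using exists_orthogonal by blast
    obtain x and m :: real where x: "norm x = 1" "\<And>i. i \<in> I \<Longrightarrow> hdot (v i) x = 0"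
        "M *v x = of_real m *s x"
      by (rule hermitian_eigenvector_orthogonal[OF assms, of "v ` I" y]) (use eig y in auto)
    have xx: "hdot x x = 1"
      using x(1) hdot_commute[of x x]
      by (auto simp: complex_eq_iff Re_hdot norm_eq_sqrt_inner)
    have xv: "hdot x (v i) = 0" if "i \<in> I" for i
      using x(2)[OF that] hdot_commute[of x "v i"] by simp
    show ?case
      by (rule exI[of _ "v(k := x)"], rule exI[of _ "l(k := m)"])
        (use insert.hyps orth eig x xx xv in auto)
  qed
qed

abbreviation spec :: "'n::finite op \<Rightarrow> ('n \<Rightarrow> real) \<Rightarrow> 'n op" where
  "spec U d \<equiv> U ** diagm d ** dagger U"

lemma psd_diagm: "(\<And>i. 0 \<le> d i) \<Longrightarrow> psd (diagm d)"
proof -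
  assume d: "\<And>i. 0 \<le> d i"
  have "Re (cnj (v $ i) * (diagm d *v v) $ i) = d i * (cmod (v $ i))\<^sup>2" for v :: "complex^'a" and i
    by (simp add: diagm_def matrix_vector_mult_def if_distrib if_distribR cmod_power2
        algebra_simps cong: if_cong) (simp add: power2_eq_square)
  then show ?thesis using d by (simp add: psd_def sum_nonneg)
qed

lemma psd_conj:
  assumes "psd M"
  shows "psd (K ** M ** dagger K)"
proof -
  have "hdot v (K ** M ** dagger K *v v) = hdot (dagger K *v v) (M *v (dagger K *v v))" for v
    by (simp add: hdot_matrix[of v K] flip: matrix_vector_mul_assoc)
  with assms show ?thesis
    by (simp add: psd_iff_hdot dagger_mult matrix_mul_assoc)
qed

text \<open>The columns of \<open>U\<close> are orthonormal eigenvectors, and each eigenvalue is the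
  value of the quadratic form at its eigenvector, hence nonnegative.\<close>

lemma psd_spectral:
  fixes M :: "'n::finite op"
  assumes "psd M"
  obtains U d where "unitary U" "\<And>i. 0 \<le> d i" "M = spec U d"
proof -
  have herm: "dagger M = M" using assms by (simp add: psd_def)
  obtain v :: "'n \<Rightarrow> complex^'n" and l :: "'n \<Rightarrow> real"
    where orth: "\<And>i j. hdot (v i) (v j) = (if i = j then 1 else 0)"
    and eig: "\<And>i. M *v v i = complex_of_real (l i) *s v i"
    using hermitian_orthonormal_eigenvectors[OF herm, of UNIV] by simp blast
  define U :: "'n op" where "U = (\<chi> i j. v j $ i)"
  have UU: "dagger U ** U = mat 1"
    using orth by (simp add: vec_eq_iff U_def dagger_def matrix_matrix_mult_def mat_def hdot_def)
  then have U: "unitary U"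
    by (simp add: unitary_def matrix_left_right_inverse)
  have "M ** U = U ** diagm l"
    using eig by (simp add: vec_eq_iff diagm_mult_right)
      (simp add: U_def matrix_matrix_mult_def matrix_vector_mult_def vector_scalar_mult_def mult.commute)
  then have "M = spec U l"
    using U by (metis unitary_def matrix_mul_assoc matrix_mul_rid)
  moreover have "0 \<le> l i" for i
  proof -
    have "0 \<le> Re (hdot (v i) (M *v v i))" using assms by (simp add: psd_iff_hdot)
    then show ?thesis by (simp add: eig hdot_smult orth)
  qed
  ultimately show ?thesis using U that by blast
qed

lemma psd_spec: "(\<And>i. 0 \<le> d i) \<Longrightarrow> psd (spec U d)"
  by (intro psd_conj psd_diagm)

section \<open>Block-diagonal operators and powers\<close>

lemma sum_UNIV_prod:
  "(\<Sum>p\<in>UNIV. h p) = (\<Sum>x\<in>(UNIV :: 'a::finite set). \<Sum>y\<in>(UNIV :: 'b::finite set). h (x, y))"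
  by (simp add: sum.cartesian_product flip: UNIV_Times_UNIV)

text \<open>Represents a classical-quantum operator by its family of blocks; products, powers,
  traces and partial traces then reduce to operations on the family.\<close>

definition block_diag :: "('m \<Rightarrow> 'n op) \<Rightarrow> ('m::finite \<times> 'n::finite) op" where
  "block_diag f = (\<chi> p q. if fst p = fst q then f (fst p) $ snd p $ snd q else 0)"

lemma block_diag_nth [simp]:
  "block_diag f $ (x, i) $ (y, j) = (if x = y then f x $ i $ j else 0)"
  by (simp add: block_diag_def)

lemma block_diag_eqI:
  "(\<And>x i y j. M $ (x, i) $ (y, j) = (if x = y then f x $ i $ j else 0)) \<Longrightarrow> M = block_diag f"
  by (simp add: vec_eq_iff)

lemma block_diag_eq_sum: "(\<Sum>x\<in>UNIV. ketbra x \<otimes> f x) = block_diag f"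
proof (rule block_diag_eqI)
  fix x i y j
  have "(\<Sum>z\<in>UNIV. (ketbra z \<otimes> f z) $ (x, i) $ (y, j)) =
      (\<Sum>z\<in>UNIV. if z = x then if x = y then f x $ i $ j else 0 else 0)"
    by (intro sum.cong) (auto simp: tensor_def ketbra_def)
  then show "(\<Sum>z\<in>UNIV. ketbra z \<otimes> f z) $ (x, i) $ (y, j) = (if x = y then f x $ i $ j else 0)"
    by simp
qed

lemma block_diag_mult: "block_diag f ** block_diag g = block_diag (\<lambda>x. f x ** g x)"
proof (rule block_diag_eqI)
  fix x i y j
  have "(\<Sum>z\<in>UNIV. \<Sum>k\<in>UNIV. block_diag f $ (x, i) $ (z, k) * block_diag g $ (z, k) $ (y, j)) =
      (\<Sum>z\<in>UNIV. if z = x then if x = y then (f x ** g x) $ i $ j else 0 else 0)"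
    by (intro sum.cong) (auto simp: matrix_matrix_mult_def)
  then show "(block_diag f ** block_diag g) $ (x, i) $ (y, j) =
      (if x = y then (f x ** g x) $ i $ j else 0)"
    by (simp add: matrix_matrix_mult_def[of "block_diag f"] sum_UNIV_prod del: block_diag_nth)
qed

lemma dagger_block_diag: "dagger (block_diag f) = block_diag (\<lambda>x. dagger (f x))"
  by (rule block_diag_eqI) (simp add: dagger_def)

lemma diagm_block_diag: "block_diag (\<lambda>x. diagm (d x)) = diagm (\<lambda>p. d (fst p) (snd p))"
  by (rule block_diag_eqI[symmetric]) (simp add: diagm_def)

lemma mat_one_block_diag: "block_diag (\<lambda>x. mat 1) = mat 1"
  by (rule block_diag_eqI[symmetric]) (simp add: mat_def)

lemma block_diag_sum: "(\<Sum>k\<in>K. block_diag (f k)) = block_diag (\<lambda>x. \<Sum>k\<in>K. f k x)"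
  by (rule block_diag_eqI) simp

lemma block_diag_scaleR: "c *\<^sub>R block_diag f = block_diag (\<lambda>x. c *\<^sub>R f x)"
  by (rule block_diag_eqI) simp

lemma trace_block_diag: "trace (block_diag f) = (\<Sum>x\<in>UNIV. trace (f x))"
  by (simp add: trace_def sum_UNIV_prod)

lemma ptrace_fst_block_diag: "ptrace_fst (block_diag f) = (\<Sum>x\<in>UNIV. f x)"
  by (simp add: ptrace_fst_def vec_eq_iff)

lemma block_block_diag: "block (block_diag f) x = f x"
  by (simp add: block_def vec_eq_iff)

lemma one_tensor: "mat 1 \<otimes> S = block_diag (\<lambda>_. S)"
  by (rule block_diag_eqI) (simp add: tensor_def mat_def)

lemma tensor_mult: "(A \<otimes> B) ** (C \<otimes> D) = (A ** C) \<otimes> (B ** D)"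
proof -
  have "(\<Sum>x\<in>UNIV. \<Sum>y\<in>UNIV. A $ i $ x * B $ j $ y * (C $ x $ k * D $ y $ l)) =
      (\<Sum>x\<in>UNIV. A $ i $ x * C $ x $ k) * (\<Sum>y\<in>UNIV. B $ j $ y * D $ y $ l)" for i j k l
    by (simp add: sum_product mult_ac)
  then show ?thesis
    by (simp add: vec_eq_iff tensor_def matrix_matrix_mult_def sum_UNIV_prod)
qed

lemma dagger_tensor: "dagger (A \<otimes> B) = dagger A \<otimes> dagger B"
  by (simp add: dagger_def tensor_def vec_eq_iff)

lemma diagm_tensor: "diagm d \<otimes> diagm e = diagm (\<lambda>p. d (fst p) * e (snd p))"
  by (auto simp: vec_eq_iff diagm_def tensor_def)

lemma mat_one_tensor: "mat 1 \<otimes> mat 1 = mat 1"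
  by (auto simp: vec_eq_iff mat_def tensor_def)

lemma trace_tensor: "trace (A \<otimes> B) = trace A * trace B"
  by (simp add: trace_def tensor_def sum_UNIV_prod sum_product)

lemma tensor_sum_left: "(\<Sum>k\<in>K. A k) \<otimes> B = (\<Sum>k\<in>K. A k \<otimes> B)"
  and tensor_sum_right: "C \<otimes> (\<Sum>k\<in>K. D k) = (\<Sum>k\<in>K. C \<otimes> D k)"
  by (simp_all add: vec_eq_iff tensor_def sum_distrib_left sum_distrib_right)

lemma tensor_scaleR: "(a *\<^sub>R A) \<otimes> (b *\<^sub>R B) = (a * b) *\<^sub>R (A \<otimes> B)"
  by (simp add: vec_eq_iff tensor_def)

lemma matrix_mult_scaleR:
  fixes A :: "'n::finite op"
  shows "(r *\<^sub>R A) ** B = r *\<^sub>R (A ** B)" and "A ** (r *\<^sub>R B) = r *\<^sub>R (A ** B)"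
  by (simp_all add: vec_eq_iff matrix_matrix_mult_def scaleR_sum_right)

lemma diagm_scaleR: "r *\<^sub>R diagm d = diagm (\<lambda>i. r * d i)"
  by (auto simp: vec_eq_iff diagm_def) (simp add: scaleR_conv_of_real)

lemma reindex_mult: "bij f \<Longrightarrow> reindex f A ** reindex f B = reindex f (A ** B)"
  using sum.reindex_bij_betw[of f UNIV UNIV "\<lambda>k. A $ f i $ k * B $ k $ f j" for i j]
  by (simp add: vec_eq_iff reindex_def matrix_matrix_mult_def)

lemma dagger_reindex: "dagger (reindex f A) = reindex f (dagger A)"
  by (simp add: dagger_def reindex_def vec_eq_iff)

lemma diagm_reindex: "inj f \<Longrightarrow> reindex f (diagm d) = diagm (\<lambda>i. d (f i))"
  by (simp add: diagm_def reindex_def vec_eq_iff inj_eq)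

lemma mat_one_reindex: "inj f \<Longrightarrow> reindex f (mat 1) = mat 1"
  by (simp add: mat_def reindex_def vec_eq_iff inj_eq)

lemma trace_reindex: "bij f \<Longrightarrow> trace (reindex f A) = trace A"
  using sum.reindex_bij_betw[of f UNIV UNIV "\<lambda>i. A $ i $ i"] by (simp add: trace_def reindex_def)

lemma reindex_sum: "(\<Sum>k\<in>K. reindex f (A k)) = reindex f (\<Sum>k\<in>K. A k)"
  by (simp add: vec_eq_iff reindex_def)

lemma trace_scaleR: "trace (r *\<^sub>R M) = of_real r * trace M" for M :: "'n::finite op"
  by (simp add: trace_def scaleR_conv_of_real[where 'a = complex] sum_distrib_left)

lemma trace_sum: "trace (\<Sum>k\<in>K. f k) = (\<Sum>k\<in>K. trace (f k))" for f :: "'k \<Rightarrow> 'n::finite op"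
  by (simp add: trace_def sum.swap[of _ K])

section \<open>Existence of real powers and rules for computing them\<close>

lemma is_powm_powm:
  assumes "psd M"
  shows "is_powm M s (powm M s)"
proof -
  obtain U d where "unitary U" "\<And>i. 0 \<le> d i" "M = spec U d"
    using psd_spectral[OF assms] by metis
  then have "is_powm M s (spec U (\<lambda>i. d i powr s))"
    by (auto simp: is_powm_def)
  then show ?thesis by (simp add: powm_unique)
qed

text \<open>Combined with \<open>is_powm_one\<close>, this turns every transport rule for
  \<open>is_powm\<close> into a proof that the same construction preserves
  \<open>psd\<close>.\<close>

lemma is_powm_psd:
  assumes "is_powm M s R"
  shows "psd M" "psd R"
  using assms by (auto simp: is_powm_def intro!: psd_spec)

lemma psd_powm: "psd M \<Longrightarrow> psd (powm M s)"
  using is_powm_powm is_powm_psd by blast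

lemma is_powm_block_diag:
  assumes "\<And>x. is_powm (f x) s (g x)"
  shows "is_powm (block_diag f) s (block_diag g)"
proof -
  have "\<exists>U d. \<forall>x. unitary (U x) \<and> (\<forall>i. 0 \<le> d x i) \<and> f x = spec (U x) (d x) \<and>
      g x = spec (U x) (\<lambda>i. d x i powr s)"
    using assms unfolding is_powm_def by metis
  then obtain U d where U: "\<And>x. unitary (U x)" and d: "\<And>x i. 0 \<le> d x i"
    and f: "\<And>x. f x = spec (U x) (d x)" and g: "\<And>x. g x = spec (U x) (\<lambda>i. d x i powr s)"
    by metis
  have spec: "block_diag (\<lambda>x. spec (U x) (e x)) = spec (block_diag U) (\<lambda>p. e (fst p) (snd p))" for e
    by (simp add: block_diag_mult dagger_block_diag diagm_block_diag[of e, symmetric])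
  have "unitary (block_diag U)"
    using U by (simp add: unitary_def block_diag_mult dagger_block_diag mat_one_block_diag)
  moreover have "block_diag f = spec (block_diag U) (\<lambda>p. d (fst p) (snd p))"
    "block_diag g = spec (block_diag U) (\<lambda>p. d (fst p) (snd p) powr s)"
    unfolding f[THEN ext] g[THEN ext] by (fact spec)+
  ultimately show ?thesis
    using d unfolding is_powm_def
    by (intro exI[of _ "block_diag U"] exI[of _ "\<lambda>p. d (fst p) (snd p)"]) simp
qed

text \<open>Eigenvalues multiply under the tensor product, and powers of nonnegative reals are
  multiplicative, also when a factor is 0.\<close>

lemma is_powm_tensor:
  assumes "is_powm A s A'" "is_powm B s B'"
  shows "is_powm (A \<otimes> B) s (A' \<otimes> B')"
proof -
  obtain U d where U: "unitary U" "\<And>i. 0 \<le> d i" "A = spec U d" "A' = spec U (\<lambda>i. d i powr s)"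
    using assms(1) by (auto simp: is_powm_def)
  obtain V e where V: "unitary V" "\<And>i. 0 \<le> e i" "B = spec V e" "B' = spec V (\<lambda>i. e i powr s)"
    using assms(2) by (auto simp: is_powm_def)
  have "unitary (U \<otimes> V)"
    using U(1) V(1) by (simp add: unitary_def tensor_mult dagger_tensor mat_one_tensor)
  moreover have "A \<otimes> B = spec (U \<otimes> V) (\<lambda>p. d (fst p) * e (snd p))"
    by (simp add: U(3) V(3) tensor_mult dagger_tensor diagm_tensor[of d e, symmetric])
  moreover have "A' \<otimes> B' = spec (U \<otimes> V) (\<lambda>p. (d (fst p) * e (snd p)) powr s)"
    using U(2) V(2)
    by (simp add: U(4) V(4) tensor_mult dagger_tensor powr_mult
        diagm_tensor[of "\<lambda>i. d i powr s" "\<lambda>i. e i powr s", symmetric])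
  ultimately show ?thesis
    using U(2) V(2) unfolding is_powm_def
    by (intro exI[of _ "U \<otimes> V"] exI[of _ "\<lambda>p. d (fst p) * e (snd p)"]) simp
qed

lemma is_powm_reindex:
  assumes "bij f" "is_powm A s A'"
  shows "is_powm (reindex f A) s (reindex f A')"
proof -
  obtain U d where U: "unitary U" "\<And>i. 0 \<le> d i" "A = spec U d" "A' = spec U (\<lambda>i. d i powr s)"
    using assms(2) by (auto simp: is_powm_def)
  have f: "inj f" using assms(1) by (simp add: bij_is_inj)
  have "unitary (reindex f U)"
    using U(1) assms(1) f by (simp add: unitary_def reindex_mult dagger_reindex mat_one_reindex)
  moreover have "reindex f (spec U e) = spec (reindex f U) (\<lambda>i. e (f i))" for e
    using assms(1) f by (simp add: reindex_mult dagger_reindex diagm_reindex[of f e, symmetric])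
  ultimately show ?thesis
    using U(2) unfolding is_powm_def U(3,4)
    by (intro exI[of _ "reindex f U"] exI[of _ "\<lambda>i. d (f i)"]) simp
qed

text \<open>The factor c = 0 is consistent with the support convention, since
  \<open>0 powr s = 0\<close> for every s; this case yields \<open>powm_zero\<close>.\<close>

lemma is_powm_scaleR:
  assumes "0 \<le> c" "is_powm A s A'"
  shows "is_powm (c *\<^sub>R A) s (c powr s *\<^sub>R A')"
proof -
  obtain U d where U: "unitary U" "\<And>i. 0 \<le> d i" "A = spec U d" "A' = spec U (\<lambda>i. d i powr s)"
    using assms(2) by (auto simp: is_powm_def)
  have "c *\<^sub>R A = spec U (\<lambda>i. c * d i)" "c powr s *\<^sub>R A' = spec U (\<lambda>i. (c * d i) powr s)"
    using assms(1) U(2)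
    by (simp_all add: U(3,4) powr_mult matrix_mult_scaleR diagm_scaleR[of c d, symmetric]
        diagm_scaleR[of "c powr s" "\<lambda>i. d i powr s", symmetric])
  then show ?thesis
    using U(1,2) assms(1) unfolding is_powm_def by (intro exI[of _ U] exI[of _ "\<lambda>i. c * d i"]) simp
qed

lemma is_powm_one:
  assumes "psd M"
  shows "is_powm M 1 M"
proof -
  obtain U d where U: "unitary U" "\<And>i. 0 \<le> d i" "M = spec U d"
    using psd_spectral[OF assms] by metis
  then show ?thesis
    unfolding is_powm_def by (intro exI[of _ U] exI[of _ d]) simp
qed

lemma psd_block_diag: "(\<And>x. psd (f x)) \<Longrightarrow> psd (block_diag f)"
  by (rule is_powm_psd(1)[OF is_powm_block_diag]) (auto intro: is_powm_one)

lemma psd_tensor: "psd A \<Longrightarrow> psd B \<Longrightarrow> psd (A \<otimes> B)"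
  by (rule is_powm_psd(1)[OF is_powm_tensor]) (auto intro: is_powm_one)

lemma psd_reindex: "bij f \<Longrightarrow> psd A \<Longrightarrow> psd (reindex f A)"
  by (rule is_powm_psd(1)[OF is_powm_reindex]) (auto intro: is_powm_one)

lemma psd_scaleR: "0 \<le> c \<Longrightarrow> psd A \<Longrightarrow> psd (c *\<^sub>R A)"
  by (rule is_powm_psd(1)[OF is_powm_scaleR]) (auto intro: is_powm_one)

lemma psd_zero: "psd 0"
  by (simp add: psd_def dagger_def vec_eq_iff)

lemma psd_add: "psd A \<Longrightarrow> psd B \<Longrightarrow> psd (A + B)"
  by (auto simp: psd_iff_hdot matrix_vector_mult_add_rdistrib hdot_add dagger_def vec_eq_iff)

lemma psd_sum: "(\<And>k. k \<in> K \<Longrightarrow> psd (f k)) \<Longrightarrow> psd (\<Sum>k\<in>K. f k)"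
  by (induction K rule: infinite_finite_induct) (auto intro: psd_zero psd_add)

lemma powm_block_diag:
  "(\<And>x. psd (f x)) \<Longrightarrow> powm (block_diag f) s = block_diag (\<lambda>x. powm (f x) s)"
  by (intro powm_unique is_powm_block_diag is_powm_powm)

lemma powm_tensor: "psd A \<Longrightarrow> psd B \<Longrightarrow> powm (A \<otimes> B) s = powm A s \<otimes> powm B s"
  by (intro powm_unique is_powm_tensor is_powm_powm)

lemma powm_reindex: "bij f \<Longrightarrow> psd A \<Longrightarrow> powm (reindex f A) s = reindex f (powm A s)"
  by (intro powm_unique is_powm_reindex is_powm_powm)

lemma powm_scaleR: "0 \<le> c \<Longrightarrow> psd A \<Longrightarrow> powm (c *\<^sub>R A) s = c powr s *\<^sub>R powm A s"
  by (intro powm_unique is_powm_scaleR is_powm_powm)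

lemma powm_zero: "powm 0 s = 0"
  using powm_scaleR[of 0 0 s] by (simp add: psd_zero)

lemma powm_one: "psd M \<Longrightarrow> powm M 1 = M"
  by (intro powm_unique is_powm_one)

lemma powm_powm:
  assumes "psd M"
  shows "powm (powm M s) t = powm M (s * t)"
proof -
  obtain U d where U: "unitary U" "\<And>i. 0 \<le> d i" "M = spec U d"
    using psd_spectral[OF assms] by metis
  then have "is_powm M s (spec U (\<lambda>i. d i powr s))" "is_powm M (s * t) (spec U (\<lambda>i. d i powr (s * t)))"
    by (auto simp: is_powm_def)
  moreover have "is_powm (spec U (\<lambda>i. d i powr s)) t (spec U (\<lambda>i. d i powr (s * t)))"
    unfolding is_powm_def
    by (rule exI[of _ U], rule exI[of _ "\<lambda>i. d i powr s"]) (simp add: U(1) powr_powr)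
  ultimately show ?thesis by (simp add: powm_unique)
qed

text \<open>Exponents add for all real s and t, negative ones included, because a zero eigenvalue
  stays 0 under every power. For s + t = 0 the product is the projection onto the support rather
  than the identity.\<close>

lemma powm_mult:
  assumes "psd M"
  shows "powm M s ** powm M t = powm M (s + t)"
proof -
  obtain U d where U: "unitary U" "\<And>i. 0 \<le> d i" "M = spec U d"
    using psd_spectral[OF assms] by metis
  then have "is_powm M r (spec U (\<lambda>i. d i powr r))" for r
    by (auto simp: is_powm_def)
  then have P: "powm M r = spec U (\<lambda>i. d i powr r)" for r
    by (rule powm_unique)
  have "spec U a ** spec U b = U ** (diagm a ** (dagger U ** U) ** diagm b) ** dagger U" for a b
    by (simp add: matrix_mul_assoc)
  also have "\<dots> a b = spec U (\<lambda>i. a i * b i)" for a b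
  proof -
    have "diagm a ** diagm b = diagm (\<lambda>i. a i * b i)"
      unfolding vec_eq_iff diagm_mult_left by (simp add: diagm_def)
    then show ?thesis using U(1) by (simp add: unitary_def)
  qed
  finally show ?thesis by (simp add: P powr_add)
qed

lemma trace_spec: "unitary U \<Longrightarrow> trace (spec U d) = of_real (\<Sum>i\<in>UNIV. d i)"
  using trace_mul_sym[of "U ** diagm d" "dagger U"]
  by (simp add: unitary_def matrix_mul_assoc) (simp add: trace_def diagm_def)

lemma trace_psd:
  assumes "psd M"
  shows "0 \<le> Re (trace M)" and "trace M = of_real (Re (trace M))" and "Re (trace M) = 0 \<longleftrightarrow> M = 0"
proof -
  obtain U d where U: "unitary U" "\<And>i. 0 \<le> d i" "M = spec U d"
    using psd_spectral[OF assms] by metis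
  then show "0 \<le> Re (trace M)" "trace M = of_real (Re (trace M))"
    by (simp_all add: trace_spec sum_nonneg)
  show "Re (trace M) = 0 \<longleftrightarrow> M = 0"
  proof
    assume "Re (trace M) = 0"
    then have "d i = 0" for i
      using U by (simp add: trace_spec sum_nonneg_eq_0_iff)
    then have "diagm d = 0" by (simp add: diagm_def vec_eq_iff)
    then show "M = 0" by (simp add: U(3))
  qed (simp add: trace_def)
qed

text \<open>A nonzero power s is undone by the power 1 / s, so it cannot annihilate a nonzero
  operator. Positivity is what allows logarithms of such traces to be split.\<close>

lemma trace_powm_pos:
  assumes "psd M" "M \<noteq> 0" "s \<noteq> 0"
  shows "0 < Re (trace (powm M s))"
proof -
  have "powm M s \<noteq> 0"
    using assms powm_powm[of M s "1 / s"] by (auto simp: powm_zero powm_one)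
  then show ?thesis
    using trace_psd[OF psd_powm[OF assms(1)], of s] by linarith
qed

section \<open>Entropies of classical-quantum states\<close>

lemma trace_zero [simp]: "trace (0 :: 'n::finite op) = 0"
  by (simp add: trace_def)

section \<open>The CNOT combinations and the entropies in terms of blocks\<close>

lemma sum_UNIV_bit: "(\<Sum>x\<in>UNIV. h x) = h 0 + h (1 :: bit)"
proof -
  have "(UNIV :: bit set) = {0, 1}" by (auto intro: bit.exhaust)
  then show ?thesis by (rule ssubst) simp
qed

lemma card_bit [simp]: "CARD(bit) = 2"
  using sum_UNIV_bit[of "\<lambda>_. 1 :: nat"] by simp

text \<open>Addition on \<open>bit\<close> is kept as a group operation, so that shifts of the
  summation variable follow from associativity and a + a = 0.\<close>

declare add_bit_eq_xor [simp del]

lemma bit_add_self [simp]: "a + a = 0" "a + (a + b) = b" for a b :: bit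
proof -
  show "a + a = 0" by (cases a) simp_all
  then show "a + (a + b) = b" by (simp flip: add.assoc)
qed

lemma sum_bit_shift: "(\<Sum>x\<in>UNIV. h (x + a)) = (\<Sum>x\<in>UNIV. h (x :: bit))"
  and sum_bit_shift_left: "(\<Sum>x\<in>UNIV. h (a + x)) = (\<Sum>x\<in>UNIV. h (x :: bit))"
  by (cases a; simp add: sum_UNIV_bit add.commute)+

lemma cnot_state_block_diag:
  "cnot_state (block_diag f) (block_diag g) = block_diag (\<lambda>u. block_diag (\<lambda>x. f (u + x) \<otimes> g x))"
proof -
  \<comment> \<open>Writing z as z + x + x makes the summand a function of u = z + x, over which the
    sum can then be taken.\<close>
  have "cnot_state (block_diag f) (block_diag g) =
      (\<Sum>x\<in>UNIV. \<Sum>z\<in>UNIV. ketbra (z + x) \<otimes> ketbra x \<otimes> f (z + x + x) \<otimes> g x)"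
    unfolding cnot_state_def block_block_diag
    by (subst sum.swap) (simp add: add.assoc)
  also have "\<dots> = (\<Sum>x\<in>UNIV. \<Sum>u\<in>UNIV. ketbra u \<otimes> ketbra x \<otimes> f (u + x) \<otimes> g x)"
    by (intro sum.cong refl sum_bit_shift)
  also have "\<dots> = (\<Sum>u\<in>UNIV. ketbra u \<otimes> (\<Sum>x\<in>UNIV. ketbra x \<otimes> f (u + x) \<otimes> g x))"
    by (subst sum.swap) (simp add: tensor_sum_right)
  finally show ?thesis by (simp add: block_diag_eq_sum)
qed

lemma circledast_block_diag:
  "block_diag f \<circledast> block_diag g = block_diag (\<lambda>x. block_diag (\<lambda>u. f (u + x) \<otimes> g x))"
  by (simp add: circledast_def cnot_state_block_diag) (auto simp: vec_eq_iff reindex_def)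

lemma boxplus_block_diag:
  "block_diag f \<boxplus> block_diag g = block_diag (\<lambda>u. \<Sum>x\<in>UNIV. f (u + x) \<otimes> g x)"
proof -
  have "block_diag f \<boxplus> block_diag g = ptrace_fst (block_diag f \<circledast> block_diag g)"
    by (simp add: boxplus_def circledast_def)
  then show ?thesis
    by (simp add: circledast_block_diag ptrace_fst_block_diag block_diag_sum)
qed

lemma H_petz_up_block_diag:
  assumes "\<And>x. psd (f x)"
  shows "H_petz_up \<beta> (block_diag f) =
    \<beta> / (1 - \<beta>) * ln (Re (trace (powm (\<Sum>x\<in>UNIV. powm (f x) \<beta>) (1 / \<beta>))))"
  by (simp add: H_petz_up_def powm_block_diag assms ptrace_fst_block_diag)

text \<open>The register u belongs to the conditioning system and survives the partial trace. The
  outer power therefore acts separately for each u, with the sum over x inside it and the sum over u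
  outside.\<close>

lemma H_petz_up_circledast:
  assumes "\<And>x. psd (f x)" "\<And>x. psd (g x)"
  shows "H_petz_up \<beta> (block_diag f \<circledast> block_diag g) = \<beta> / (1 - \<beta>) *
    ln (Re (\<Sum>u\<in>UNIV. trace (powm (\<Sum>x\<in>UNIV. powm (f (u + x)) \<beta> \<otimes> powm (g x) \<beta>) (1 / \<beta>))))"
  by (simp add: circledast_block_diag H_petz_up_block_diag assms powm_block_diag block_diag_sum
      trace_block_diag powm_tensor psd_block_diag psd_tensor psd_powm psd_sum)

text \<open>The blocks of the sandwiched operator: the marginal of \<open>block_diag f\<close> is
  the sum of its blocks, and its power tensored with the identity multiplies every block by the same
  \<open>S\<close> on both sides.\<close>

definition tilt :: "real \<Rightarrow> ('a::finite \<Rightarrow> 'b op) \<Rightarrow> 'a \<Rightarrow> 'b::finite op" where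
  "tilt \<alpha> f x =
     (let S = powm (\<Sum>x\<in>UNIV. f x) ((1 - \<alpha>) / (2 * \<alpha>)) in S ** f x ** S)"

lemma sandwich_block_diag: "sandwich \<alpha> (block_diag f) = block_diag (tilt \<alpha> f)"
  by (simp add: sandwich_def tilt_def[abs_def] Let_def ptrace_fst_block_diag one_tensor block_diag_mult)

lemma psd_tilt:
  assumes "\<And>x. psd (f x)"
  shows "psd (tilt \<alpha> f x)"
proof -
  have "psd (powm (\<Sum>x\<in>UNIV. f x) s)" for s
    using assms by (intro psd_powm psd_sum)
  then have "dagger (powm (\<Sum>x\<in>UNIV. f x) s) = powm (\<Sum>x\<in>UNIV. f x) s" for s
    by (simp add: psd_def)
  then show ?thesis
    using psd_conj[OF assms] unfolding tilt_def Let_def by metis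
qed

lemma matrix_mult_sum:
  fixes A :: "'n::finite op"
  shows "A ** (\<Sum>k\<in>K. f k) = (\<Sum>k\<in>K. A ** f k)" and "(\<Sum>k\<in>K. f k) ** A = (\<Sum>k\<in>K. f k ** A)"
  by (simp_all add: vec_eq_iff matrix_matrix_mult_def sum_distrib_left sum_distrib_right sum.swap[of _ K])

lemma sum_tilt:
  assumes "\<And>x. psd (f x)" "\<alpha> \<noteq> 0"
  shows "(\<Sum>x\<in>UNIV. tilt \<alpha> f x) = powm (\<Sum>x\<in>UNIV. f x) (1 / \<alpha>)"
proof -
  let ?R = "\<Sum>x\<in>UNIV. f x" and ?s = "(1 - \<alpha>) / (2 * \<alpha>)"
  have R: "psd ?R" using assms(1) by (intro psd_sum)
  \<comment> \<open>The middle factor is the marginal itself, written as its first power so that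
    only exponents remain to be added.\<close>
  have "(\<Sum>x\<in>UNIV. tilt \<alpha> f x) = powm ?R ?s ** powm ?R 1 ** powm ?R ?s"
    by (simp add: tilt_def Let_def powm_one R matrix_mult_sum)
  also have "\<dots> = powm ?R (?s + 1 + ?s)"
    by (simp add: powm_mult R)
  also have "?s + 1 + ?s = 1 / \<alpha>"
    using assms(2) by (simp add: field_simps)
  finally show ?thesis .
qed

text \<open>The power of the product marginal splits into one factor per channel, so multiplying by
  it on both sides passes through the sum over x and tilts each tensor factor by its own
  marginal.\<close>

lemma tilt_convolution:
  assumes "\<And>x. psd (f x)" "\<And>x. psd (g x)"
  shows "tilt \<alpha> (\<lambda>u. \<Sum>x\<in>UNIV. f (u + x) \<otimes> g x) (u :: bit) =
    (\<Sum>x\<in>UNIV. tilt \<alpha> f (u + x) \<otimes> tilt \<alpha> g x)"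
proof -
  have "(\<Sum>u\<in>UNIV. \<Sum>x\<in>UNIV. f (u + x) \<otimes> g x) = (\<Sum>x\<in>UNIV. \<Sum>u\<in>UNIV. f u \<otimes> g x)"
    by (subst sum.swap) (simp add: sum_bit_shift[of "\<lambda>u. f u \<otimes> g _"])
  also have "\<dots> = (\<Sum>u\<in>UNIV. f u) \<otimes> (\<Sum>x\<in>UNIV. g x)"
    by (simp add: tensor_sum_left tensor_sum_right)
  finally show ?thesis
    by (simp add: tilt_def Let_def powm_tensor psd_sum assms matrix_mult_sum tensor_mult)
qed

lemma H_sandwiched_down_block_diag:
  assumes "\<And>x. psd (f x)"
  shows "H_sandwiched_down \<alpha> (block_diag f) =
    1 / (1 - \<alpha>) * ln (Re (\<Sum>x\<in>UNIV. trace (powm (tilt \<alpha> f x) \<alpha>)))"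
  by (simp add: H_sandwiched_down_def sandwich_block_diag powm_block_diag psd_tilt assms trace_block_diag)

text \<open>A nonzero sum has a nonzero term, whose trace is positive, while the other traces are
  nonnegative.\<close>

lemma sum_trace_powm_pos:
  assumes "\<And>x. psd (f x)" "(\<Sum>x\<in>UNIV. f x) \<noteq> 0" "s \<noteq> 0"
  shows "0 < Re (\<Sum>x\<in>UNIV. trace (powm (f (x :: 'a :: finite)) s))"
proof -
  obtain x where "f x \<noteq> 0" using assms(2) by (meson sum.neutral)
  then have "0 < (\<Sum>x\<in>UNIV. Re (trace (powm (f x) s)))"
    using assms by (intro sum_pos2[of _ x]) (auto intro: trace_powm_pos trace_psd psd_powm)
  then show ?thesis by simp
qed

section \<open>Passing between families of blocks and classical-quantum states\<close>

lemma density_op_ketbra: "density_op (ketbra k)"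
proof -
  have "ketbra k = diagm (\<lambda>i. if i = k then 1 else 0)"
    by (auto simp: ketbra_def diagm_def vec_eq_iff)
  then have "psd (ketbra k)" by (simp add: psd_diagm)
  then show ?thesis by (simp add: density_op_def trace_def ketbra_def)
qed

lemma cq_state_iff_block_diag:
  fixes \<rho> :: "(bit \<times> 'b::finite) op"
  shows
  "cq_state p \<rho> \<longleftrightarrow> (\<forall>x. 0 \<le> p x) \<and> (\<Sum>x\<in>UNIV. p x) = 1 \<and>
     (\<exists>\<sigma>. (\<forall>x. density_op (\<sigma> x)) \<and> \<rho> = block_diag (\<lambda>x. p x *\<^sub>R \<sigma> x))"
proof -
  have "p x *\<^sub>R (ketbra x \<otimes> \<sigma> x) = ketbra x \<otimes> (p x *\<^sub>R \<sigma> x)" for x and \<sigma> :: "bit \<Rightarrow> 'b op"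
    using tensor_scaleR[of 1 "ketbra x" "p x" "\<sigma> x"] by simp
  then show ?thesis by (simp add: cq_state_def block_diag_eq_sum)
qed

lemma cq_state_block_diag:
  assumes "\<And>x. psd (f x)" "(\<Sum>x\<in>UNIV. trace (f x)) = 1"
  shows "cq_state (\<lambda>x. Re (trace (f x))) (block_diag f)"
proof -
  \<comment> \<open>A zero block cannot be normalized; its weight is 0, so any density operator may
    stand there.\<close>
  define \<sigma> where "\<sigma> x = (if f x = 0 then ketbra undefined else (1 / Re (trace (f x))) *\<^sub>R f x)" for x
  have "density_op (\<sigma> x)" for x
  proof (cases "f x = 0")
    case False
    define r where "r = Re (trace (f x))"
    have "0 \<le> r" "trace (f x) = of_real r" "r \<noteq> 0"
      using trace_psd[OF assms(1)[of x]] False by (simp_all add: r_def)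
    then show ?thesis
      using False assms(1)[of x] by (simp add: \<sigma>_def density_op_def psd_scaleR trace_scaleR)
  qed (simp add: \<sigma>_def density_op_ketbra)
  moreover have "Re (trace (f x)) *\<^sub>R \<sigma> x = f x" for x
    using trace_psd(3)[OF assms(1)[of x]] by (simp add: \<sigma>_def)
  moreover have "(\<Sum>x\<in>UNIV. Re (trace (f x))) = 1"
    using assms(2) by (metis Re_sum one_complex.sel(1))
  ultimately show ?thesis
    using trace_psd(1)[OF assms(1)] unfolding cq_state_iff_block_diag by (metis (no_types, lifting) ext)
qed

text \<open>The weight 1/2 is absorbed into the blocks, which become subnormalized states with total
  trace 1.\<close>

lemma channelE:
  assumes "channel W"
  obtains f where "W = block_diag f" "\<And>x. psd (f x)" "trace (\<Sum>x\<in>UNIV. f x) = 1"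
proof -
  obtain \<sigma> where \<sigma>: "\<And>x. density_op (\<sigma> x)" "W = block_diag (\<lambda>x. (1 / 2) *\<^sub>R \<sigma> x)"
    using assms unfolding channel_def cq_state_iff_block_diag by blast
  show ?thesis
    by (rule that[OF \<sigma>(2)]) (use \<sigma>(1) in \<open>auto simp: density_op_def psd_scaleR trace_sum trace_scaleR\<close>)
qed

text \<open>
  Storing beside the output the bit that was added to the input makes the input uniform and
  leaves the entropies unchanged.
\<close>

definition symmetrize :: "(bit \<Rightarrow> 'b::finite op) \<Rightarrow> bit \<Rightarrow> ('b \<times> bit) op" where
  "symmetrize f x = (1 / 2) *\<^sub>R reindex prod.swap (block_diag (\<lambda>t. f (x + t)))"

lemma psd_symmetrize: "(\<And>x. psd (f x)) \<Longrightarrow> psd (symmetrize f x)"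
  by (simp add: symmetrize_def psd_scaleR psd_reindex psd_block_diag)

lemma powm_symmetrize:
  "(\<And>x. psd (f x)) \<Longrightarrow> powm (symmetrize f x) s =
    (1 / 2) powr s *\<^sub>R reindex prod.swap (block_diag (\<lambda>t. powm (f (x + t)) s))"
  by (simp add: symmetrize_def powm_scaleR psd_reindex psd_block_diag powm_reindex powm_block_diag)

text \<open>For either input x the shift t runs over both bits, so each conditional output contains
  both blocks of \<open>f\<close> and has the full trace 1.\<close>

lemma channel_symmetrize:
  assumes "\<And>x. psd (f x)" "(\<Sum>x\<in>UNIV. trace (f x)) = 1"
  shows "channel (block_diag (symmetrize f))"
proof -
  have "density_op (reindex prod.swap (block_diag (\<lambda>t. f (x + t))))" for x
    using assms by (simp add: density_op_def psd_reindex psd_block_diag trace_reindex trace_block_diag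
        sum_bit_shift_left[of "\<lambda>t. trace (f t)"])
  then show ?thesis
    unfolding channel_def cq_state_iff_block_diag symmetrize_def[abs_def]
    by (intro conjI exI[of _ "\<lambda>x. reindex prod.swap (block_diag (\<lambda>t. f (x + t)))"]) simp_all
qed

text \<open>After summing over x, every value of the appended bit carries the same operator. The
  outer power 1 / \<beta> turns the factor (1/2) powr \<beta> back into 1/2, which cancels against
  the two copies.\<close>

lemma H_petz_up_symmetrize:
  assumes f: "\<And>x. psd (f x)" and "\<beta> \<noteq> 0"
  shows "H_petz_up \<beta> (block_diag (symmetrize f)) = H_petz_up \<beta> (block_diag f)"
proof -
  let ?S = "\<Sum>x\<in>UNIV. powm (f x) \<beta>"
  have S: "psd ?S" using f by (intro psd_sum psd_powm)
  have "(\<Sum>x\<in>UNIV. powm (symmetrize f x) \<beta>) =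
      (1 / 2) powr \<beta> *\<^sub>R reindex prod.swap (block_diag (\<lambda>_ :: bit. ?S))"
    by (simp add: powm_symmetrize f reindex_sum block_diag_sum
        sum_bit_shift[of "\<lambda>x. powm (f x) \<beta>"] flip: scaleR_sum_right)
  then have "powm (\<Sum>x\<in>UNIV. powm (symmetrize f x) \<beta>) (1 / \<beta>) =
      (1 / 2) *\<^sub>R reindex prod.swap (block_diag (\<lambda>_ :: bit. powm ?S (1 / \<beta>)))"
    using S \<open>\<beta> \<noteq> 0\<close>
    by (simp add: powm_scaleR psd_reindex psd_block_diag powm_reindex powm_block_diag powr_powr)
  then have "trace (powm (\<Sum>x\<in>UNIV. powm (symmetrize f x) \<beta>) (1 / \<beta>)) = trace (powm ?S (1 / \<beta>))"
    by (simp add: trace_scaleR trace_reindex trace_block_diag)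
  then show ?thesis
    by (simp add: H_petz_up_block_diag psd_symmetrize f)
qed

text \<open>Moves the two appended bits to the front, so that a tensor product of symmetrized
  outputs becomes block diagonal in the pair of shifts.\<close>

definition pull_bits :: "('b \<times> bit) \<times> 'c \<times> bit \<Rightarrow> (bit \<times> bit) \<times> 'b \<times> 'c" where
  "pull_bits = (\<lambda>((b, s), c, t). ((s, t), b, c))"

lemma bij_pull_bits: "bij pull_bits"
  by (rule o_bij[of "\<lambda>((s, t), b, c). ((b, s), c, t)"]) (auto simp: pull_bits_def)

lemma tensor_reindex_swap:
  "reindex prod.swap (block_diag f) \<otimes> reindex prod.swap (block_diag g) =
    reindex pull_bits (block_diag (\<lambda>p. f (fst p) \<otimes> g (snd p)))"
  by (auto simp: vec_eq_iff reindex_def tensor_def pull_bits_def)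

text \<open>The shifts s and t only translate the register u by s + t, and the entropy sums over u.
  The four pairs of shifts thus contribute equally.\<close>

lemma H_petz_up_symmetrize_circledast:
  assumes f: "\<And>x. psd (f x)" and g: "\<And>x. psd (g x)" and "\<beta> \<noteq> 0"
  shows "H_petz_up \<beta> (block_diag (symmetrize f) \<circledast> block_diag (symmetrize g)) =
    H_petz_up \<beta> (block_diag f \<circledast> block_diag g)"
proof -
  define Y where "Y u = (\<Sum>x\<in>UNIV. powm (f (u + x)) \<beta> \<otimes> powm (g x) \<beta>)" for u
  have Y: "psd (Y u)" for u
    unfolding Y_def using f g by (intro psd_sum psd_tensor psd_powm)
  \<comment> \<open>The uniform weight of the pairs (s, t) after the outer power; it cancels their
    number, four.\<close>
  have c: "((1 / 2) powr \<beta> * (1 / 2) powr \<beta>) powr (1 / \<beta>) = (1 / 4 :: real)"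
    using \<open>\<beta> \<noteq> 0\<close> by (simp add: powr_mult powr_powr)
  \<comment> \<open>Replacing x by x + t moves the shift of g onto f.\<close>
  have conv: "(\<Sum>x\<in>UNIV. powm (f (u + x + s)) \<beta> \<otimes> powm (g (x + t)) \<beta>) = Y (u + s + t)" for u s t
    using sum_bit_shift[of "\<lambda>x. powm (f (u + x + s + t)) \<beta> \<otimes> powm (g x) \<beta>" t]
    by (simp add: Y_def add_ac)
  have "(\<Sum>x\<in>UNIV. powm (symmetrize f (u + x)) \<beta> \<otimes> powm (symmetrize g x) \<beta>) =
      ((1 / 2) powr \<beta> * (1 / 2) powr \<beta>) *\<^sub>R
        reindex pull_bits (block_diag (\<lambda>p. Y (u + fst p + snd p)))" for u
    by (simp add: powm_symmetrize f g tensor_scaleR tensor_reindex_swap reindex_sum block_diag_sum conv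
        flip: scaleR_sum_right)
  then have "powm (\<Sum>x\<in>UNIV. powm (symmetrize f (u + x)) \<beta> \<otimes> powm (symmetrize g x) \<beta>) (1 / \<beta>) =
      (1 / 4) *\<^sub>R reindex pull_bits (block_diag (\<lambda>p. powm (Y (u + fst p + snd p)) (1 / \<beta>)))" for u
    using c by (simp add: powm_scaleR psd_reindex psd_block_diag powm_reindex powm_block_diag Y bij_pull_bits)
  then have "(\<Sum>u\<in>UNIV. trace (powm (\<Sum>x\<in>UNIV. powm (symmetrize f (u + x)) \<beta> \<otimes>
        powm (symmetrize g x) \<beta>) (1 / \<beta>))) = (\<Sum>u\<in>UNIV. trace (powm (Y u) (1 / \<beta>)))"
    by (simp add: trace_scaleR trace_reindex bij_pull_bits trace_block_diag sum_UNIV_prod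
        sum_UNIV_bit field_simps)
  then show ?thesis
    by (simp add: H_petz_up_circledast psd_symmetrize f g flip: Y_def)
qed

section \<open>The normalized states and the entropy identity\<close>

definition bar :: "real \<Rightarrow> (bit \<Rightarrow> 'b::finite op) \<Rightarrow> bit \<Rightarrow> 'b op" where
  "bar \<alpha> f x = (1 / Re (\<Sum>y\<in>UNIV. trace (powm (tilt \<alpha> f y) \<alpha>))) *\<^sub>R powm (tilt \<alpha> f x) \<alpha>"

lemma rho_bar_block_diag:
  "(\<And>x. psd (f x)) \<Longrightarrow> rho_bar \<alpha> (block_diag f) = block_diag (bar \<alpha> f)"
  by (simp add: rho_bar_def sandwich_block_diag powm_block_diag psd_tilt trace_block_diag
      block_diag_scaleR bar_def[abs_def])

locale bar_state =
  fixes \<alpha> :: real and f :: "bit \<Rightarrow> 'b::finite op"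
  assumes \<alpha>: "0 < \<alpha>" "\<alpha> \<noteq> 1" and f: "\<And>x. psd (f x)" and tr: "trace (\<Sum>x\<in>UNIV. f x) = 1"
begin

text \<open>Both the normalization of \<open>bar\<close> and the argument of the logarithm in the
  sandwiched entropy; the entropy equality rests on this double role.\<close>

definition Z :: real where "Z = Re (\<Sum>x\<in>UNIV. trace (powm (tilt \<alpha> f x) \<alpha>))"

text \<open>By \<open>sum_tilt\<close> this is the trace of a nonzero power of the marginal, and the
  marginal is nonzero because its trace is 1.\<close>

lemma trace_sum_tilt_pos: "0 < Re (trace (\<Sum>x\<in>UNIV. tilt \<alpha> f x))"
proof -
  have "(\<Sum>x\<in>UNIV. f x) \<noteq> 0" using tr by auto
  then show ?thesis
    using \<alpha> f by (simp add: sum_tilt trace_powm_pos psd_sum)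
qed

lemma Z_pos: "0 < Z"
proof -
  have "(\<Sum>x\<in>UNIV. tilt \<alpha> f x) \<noteq> 0"
    using trace_sum_tilt_pos by auto
  then show ?thesis
    using \<alpha> f unfolding Z_def by (intro sum_trace_powm_pos) (auto intro: psd_tilt)
qed

lemma psd_bar: "psd (bar \<alpha> f x)"
  using Z_pos f by (simp add: bar_def psd_scaleR psd_powm psd_tilt del: Re_sum flip: Z_def)

lemma trace_bar: "(\<Sum>x\<in>UNIV. trace (bar \<alpha> f x)) = 1"
proof -
  have "(\<Sum>x\<in>UNIV. trace (powm (tilt \<alpha> f x) \<alpha>)) = of_real Z"
    using trace_psd(2)[OF psd_block_diag[of "\<lambda>x. powm (tilt \<alpha> f x) \<alpha>"]] f
    by (simp add: Z_def psd_powm psd_tilt trace_block_diag)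
  then show ?thesis
    using Z_pos by (simp add: bar_def trace_scaleR del: Re_sum flip: Z_def sum_divide_distrib)
qed

lemma powm_bar: "powm (bar \<alpha> f x) (1 / \<alpha>) = (1 / Z) powr (1 / \<alpha>) *\<^sub>R tilt \<alpha> f x"
  using Z_pos f \<alpha>
  by (simp add: bar_def powm_scaleR powm_powm powm_one psd_powm psd_tilt del: Re_sum flip: Z_def)

lemma H_sandwiched_down_eq: "H_sandwiched_down \<alpha> (block_diag f) = 1 / (1 - \<alpha>) * ln Z"
  by (simp add: H_sandwiched_down_block_diag f Z_def)

lemma H_petz_up_bar: "H_petz_up (1 / \<alpha>) (block_diag (bar \<alpha> f)) = 1 / (1 - \<alpha>) * ln Z"
proof -
  have R: "psd (\<Sum>x\<in>UNIV. f x)" using f by (intro psd_sum)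
  have "(\<Sum>x\<in>UNIV. powm (bar \<alpha> f x) (1 / \<alpha>)) =
      (1 / Z) powr (1 / \<alpha>) *\<^sub>R powm (\<Sum>x\<in>UNIV. f x) (1 / \<alpha>)"
    using \<alpha> f by (simp add: powm_bar sum_tilt flip: scaleR_sum_right)
  \<comment> \<open>The outer power \<alpha> undoes 1 / \<alpha> on the marginal and on the scalar
    alike; as the marginal has trace 1, only 1 / Z enters the logarithm.\<close>
  then have "powm (\<Sum>x\<in>UNIV. powm (bar \<alpha> f x) (1 / \<alpha>)) \<alpha> = (1 / Z) *\<^sub>R (\<Sum>x\<in>UNIV. f x)"
    using \<alpha> R Z_pos by (simp add: powm_scaleR powm_powm powm_one psd_powm powr_powr)
  then have "H_petz_up (1 / \<alpha>) (block_diag (bar \<alpha> f)) = 1 / \<alpha> / (1 - 1 / \<alpha>) * ln (1 / Z)"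
    by (simp add: H_petz_up_block_diag psd_bar trace_scaleR tr)
  then show ?thesis
    using \<alpha> Z_pos by (simp add: ln_div field_simps)
qed

end

lemma H_petz_up_bar_circledast:
  assumes "bar_state \<alpha> f" "bar_state \<alpha> g"
  shows "H_petz_up (1 / \<alpha>) (block_diag (bar \<alpha> f) \<circledast> block_diag (bar \<alpha> g)) =
    H_sandwiched_down \<alpha> (block_diag f) + H_sandwiched_down \<alpha> (block_diag g)
      - H_sandwiched_down \<alpha> (block_diag f \<boxplus> block_diag g)"
proof -
  interpret f: bar_state \<alpha> f by fact
  interpret g: bar_state \<alpha> g by fact
  note \<alpha> = f.\<alpha>
  define Y where "Y u = (\<Sum>x\<in>UNIV. tilt \<alpha> f (u + x) \<otimes> tilt \<alpha> g x)" for u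
  define y where "y = Re (\<Sum>u\<in>UNIV. trace (powm (Y u) \<alpha>))"
  have Y: "psd (Y u)" for u
    unfolding Y_def using f.f g.f by (intro psd_sum psd_tensor psd_tilt)
  \<comment> \<open>The total of \<open>Y\<close> is a tensor product of two operators of positive
    trace, hence nonzero. This gives y > 0, needed to split the logarithm below.\<close>
  have "(\<Sum>u\<in>UNIV. Y u) = (\<Sum>x\<in>UNIV. \<Sum>u\<in>UNIV. tilt \<alpha> f u \<otimes> tilt \<alpha> g x)"
    unfolding Y_def by (subst sum.swap) (simp add: sum_bit_shift[of "\<lambda>u. tilt \<alpha> f u \<otimes> tilt \<alpha> g _"])
  also have "\<dots> = (\<Sum>u\<in>UNIV. tilt \<alpha> f u) \<otimes> (\<Sum>x\<in>UNIV. tilt \<alpha> g x)"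
    by (simp add: tensor_sum_left tensor_sum_right)
  finally have "trace (\<Sum>u\<in>UNIV. Y u) \<noteq> 0"
    using f.trace_sum_tilt_pos g.trace_sum_tilt_pos by (auto simp: trace_tensor)
  then have "(\<Sum>u\<in>UNIV. Y u) \<noteq> 0" by auto
  then have y: "0 < y"
    unfolding y_def using Y \<alpha> by (intro sum_trace_powm_pos) auto
  have box: "H_sandwiched_down \<alpha> (block_diag f \<boxplus> block_diag g) = 1 / (1 - \<alpha>) * ln y"
    by (simp add: boxplus_block_diag H_sandwiched_down_block_diag psd_sum psd_tensor f.f g.f
        tilt_convolution y_def Y_def)
  have "(\<Sum>x\<in>UNIV. powm (bar \<alpha> f (u + x)) (1 / \<alpha>) \<otimes> powm (bar \<alpha> g x) (1 / \<alpha>)) =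
      ((1 / f.Z) powr (1 / \<alpha>) * (1 / g.Z) powr (1 / \<alpha>)) *\<^sub>R Y u" for u
    by (simp add: f.powm_bar g.powm_bar tensor_scaleR Y_def flip: scaleR_sum_right)
  \<comment> \<open>The outer power reduces both scalars to 1 / Z and leaves the powers of
    \<open>Y u\<close> whose traces define the boxplus entropy in \<open>box\<close>.\<close>
  then have "powm (\<Sum>x\<in>UNIV. powm (bar \<alpha> f (u + x)) (1 / \<alpha>) \<otimes> powm (bar \<alpha> g x) (1 / \<alpha>)) \<alpha> =
      (1 / (f.Z * g.Z)) *\<^sub>R powm (Y u) \<alpha>" for u
    using Y \<alpha> f.Z_pos g.Z_pos by (simp add: powm_scaleR powr_mult powr_powr)
  then have "H_petz_up (1 / \<alpha>) (block_diag (bar \<alpha> f) \<circledast> block_diag (bar \<alpha> g)) =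
      1 / \<alpha> / (1 - 1 / \<alpha>) * ln (1 / (f.Z * g.Z) * y)"
    by (simp add: H_petz_up_circledast f.psd_bar g.psd_bar trace_scaleR y_def flip: sum_divide_distrib)
  also have "1 / \<alpha> / (1 - 1 / \<alpha>) = - (1 / (1 - \<alpha>))"
    using \<alpha> by (simp add: field_simps)
  also have "ln (1 / (f.Z * g.Z) * y) = ln y - ln f.Z - ln g.Z"
    using y f.Z_pos g.Z_pos by (simp add: ln_div ln_mult)
  finally show ?thesis
    unfolding box f.H_sandwiched_down_eq g.H_sandwiched_down_eq by (simp add: algebra_simps)
qed

text \<open>The existential conjunct is witnessed by the symmetrized blocks of
  \<open>rho_bar\<close>, whence the additional \<open>bit\<close> in the output types; the
  remaining conjuncts concern \<open>rho_bar\<close> itself.\<close>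

theorem lemmaV1:
  fixes \<alpha> :: real
    and W\<^sub>1 :: "(bit \<times> 'b::finite) op" and W\<^sub>2 :: "(bit \<times> 'c::finite) op"
  assumes "0 < \<alpha>" and "\<alpha> \<noteq> 1"
    and "channel W\<^sub>1" and "channel W\<^sub>2"
  shows
    "(\<exists>(W\<^sub>1' :: (bit \<times> 'b \<times> bit) op) (W\<^sub>2' :: (bit \<times> 'c \<times> bit) op).
        channel W\<^sub>1' \<and> channel W\<^sub>2' \<and>
        H_sandwiched_down \<alpha> W\<^sub>1 = H_petz_up (1 / \<alpha>) W\<^sub>1' \<and>
        H_sandwiched_down \<alpha> W\<^sub>2 = H_petz_up (1 / \<alpha>) W\<^sub>2' \<and>
        H_sandwiched_down \<alpha> W\<^sub>1 + H_sandwiched_down \<alpha> W\<^sub>2 =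
          H_petz_up (1 / \<alpha>) (W\<^sub>1' \<circledast> W\<^sub>2') + H_sandwiched_down \<alpha> (W\<^sub>1 \<boxplus> W\<^sub>2)) \<and>
     (\<exists>p. cq_state p (rho_bar \<alpha> W\<^sub>1)) \<and> (\<exists>p. cq_state p (rho_bar \<alpha> W\<^sub>2)) \<and>
     H_sandwiched_down \<alpha> W\<^sub>1 = H_petz_up (1 / \<alpha>) (rho_bar \<alpha> W\<^sub>1) \<and>
     H_sandwiched_down \<alpha> W\<^sub>2 = H_petz_up (1 / \<alpha>) (rho_bar \<alpha> W\<^sub>2) \<and>
     H_sandwiched_down \<alpha> W\<^sub>1 + H_sandwiched_down \<alpha> W\<^sub>2 =
       H_petz_up (1 / \<alpha>) (rho_bar \<alpha> W\<^sub>1 \<circledast> rho_bar \<alpha> W\<^sub>2) +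
       H_sandwiched_down \<alpha> (W\<^sub>1 \<boxplus> W\<^sub>2)"
proof -
  obtain f where W1: "W\<^sub>1 = block_diag f" and f: "\<And>x. psd (f x)" "trace (\<Sum>x\<in>UNIV. f x) = 1"
    using channelE[OF assms(3)] by metis
  obtain g where W2: "W\<^sub>2 = block_diag g" and g: "\<And>x. psd (g x)" "trace (\<Sum>x\<in>UNIV. g x) = 1"
    using channelE[OF assms(4)] by metis
  have bars: "bar_state \<alpha> f" "bar_state \<alpha> g"
    using assms(1,2) f g by (simp_all add: bar_state_def)
  note bar_facts = bars[THEN bar_state.psd_bar] bars[THEN bar_state.trace_bar]
    bars[THEN bar_state.H_sandwiched_down_eq] bars[THEN bar_state.H_petz_up_bar]
  have \<alpha>: "1 / \<alpha> \<noteq> 0" using assms(1) by simp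
  note bar_eq = rho_bar_block_diag[of f \<alpha>, OF f(1), folded W1]
    rho_bar_block_diag[of g \<alpha>, OF g(1), folded W2]
  have bar_entropy: "H_sandwiched_down \<alpha> W\<^sub>1 = H_petz_up (1 / \<alpha>) (rho_bar \<alpha> W\<^sub>1)"
    "H_sandwiched_down \<alpha> W\<^sub>2 = H_petz_up (1 / \<alpha>) (rho_bar \<alpha> W\<^sub>2)"
    "H_sandwiched_down \<alpha> W\<^sub>1 + H_sandwiched_down \<alpha> W\<^sub>2 =
       H_petz_up (1 / \<alpha>) (rho_bar \<alpha> W\<^sub>1 \<circledast> rho_bar \<alpha> W\<^sub>2) + H_sandwiched_down \<alpha> (W\<^sub>1 \<boxplus> W\<^sub>2)"
    using H_petz_up_bar_circledast[OF bars] by (simp_all add: bar_eq bar_facts)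
      (simp_all add: W1 W2 bar_facts)
  have "\<exists>p. cq_state p (rho_bar \<alpha> W\<^sub>1)" "\<exists>p. cq_state p (rho_bar \<alpha> W\<^sub>2)"
    unfolding bar_eq by (rule exI, rule cq_state_block_diag, rule bar_facts, rule bar_facts)+
  moreover have "channel (block_diag (symmetrize (bar \<alpha> f)))" "channel (block_diag (symmetrize (bar \<alpha> g)))"
    by (rule channel_symmetrize, rule bar_facts, rule bar_facts)+
  moreover have "H_petz_up (1 / \<alpha>) (block_diag (symmetrize (bar \<alpha> f))) = H_petz_up (1 / \<alpha>) (rho_bar \<alpha> W\<^sub>1)"
    "H_petz_up (1 / \<alpha>) (block_diag (symmetrize (bar \<alpha> g))) = H_petz_up (1 / \<alpha>) (rho_bar \<alpha> W\<^sub>2)"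
    "H_petz_up (1 / \<alpha>) (block_diag (symmetrize (bar \<alpha> f)) \<circledast> block_diag (symmetrize (bar \<alpha> g))) =
       H_petz_up (1 / \<alpha>) (rho_bar \<alpha> W\<^sub>1 \<circledast> rho_bar \<alpha> W\<^sub>2)"
    unfolding bar_eq
    by (intro H_petz_up_symmetrize H_petz_up_symmetrize_circledast bar_facts \<alpha>)+
  ultimately show ?thesis
    using bar_entropy by metis
qed

end
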